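(* Let $\mu>0$. Suppose that $f:\mathbb{R}^d\to\mathbb{R}$ is $\mu$-strongly convex and twice continuously differentiable with minimizer $x^*$, that the symmetric Hessian approximation satisfies $\|H(x)-\nabla^2 f(x)\|\le\delta$ for all $x$, and that $f$ satisfies either the global or the local generalized Hessian smoothness condition (with constants $M_0,M_1\ge0$, and radius $\rho>0$ in the local case). Let $r_0=\min\{\rho/2,\,1/(6\sqrt{M_1})\}$, $\delta_k=\|H(x_k)-\nabla^2f(x_k)\|\le\delta$, and $$\overline\tau=\max\left\{\eta_0,\ 8\delta+48M_0\sqrt{\frac{2(f(x_0)-f^* )}{\mu}},\ \frac{2(f(x_0)-f^* )}{r_0^2}\right\}.$$ Every completed iteration $k$ of the adaptive regularized Newton method started from $x_0$ with $\eta_0>0$ satisfies $\tau_k\le\overline\tau$ and $$\tau_k\le 8\max_{0\le j\le k}2^{j-k}\delta_j+\overline\tau\left(1-\frac{2\mu}{3\overline\tau+2\mu}\right)^k,$$ $$f(x_{k+1})-f^*\le\left(1-\frac{2\mu}{3\tau_k+2\mu}\right)^2\big(f(x_k)-f^*\big).$$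
   Context: $\|\cdot\|$ is the Euclidean norm for vectors and the induced operator norm for matrices; $f^*=f(x^* )$. Conventions: $a/(+\infty)=0$ for finite $a\ge0$, and $1/\sqrt{M_1}=+\infty$ if $M_1=0$. Strong convexity: $f(y)\ge f(x)+\langle\nabla f(x),y-x\rangle+\frac\mu2\|y-x\|^2$ for all $x,y$. Put $L(x)=M_0+M_1\|\nabla f(x)\|$. Global generalized Hessian smoothness: $\|\nabla^2f(y)-\nabla^2f(x)\|\le L(x)\|y-x\|$ for all $x,y\in\mathbb{R}^d$; in this case set $\rho=+\infty$. Local generalized Hessian smoothness with radius $\rho>0$: the same inequality for all $x,y$ with $\|y-x\|\le\rho$. Procedure $\mathrm{MSBacktrack}(x,\tau)$ (for $x\in\mathbb{R}^d$, $\tau>0$): repeat the following trial. If $H(x)+\tau I\succ0$, solve $(H(x)+\tau I)s=-\nabla f(x)$; if moreover $\|\nabla f(x+s)+\tau s\|\le\frac{\tau}{2}\|s\|$, return the pair $(x+s,\tau)$. Otherwise (trial rejected) replace $\tau$ by $2\tau$. Adaptive regularized Newton method. Input $x_0\in\mathbb{R}^d$, $\eta_0>0$. For $k\ge0$: $(x_{k+1},\tau_k)=\mathrm{MSBacktrack}(x_k,\eta_k)$ and $\eta_{k+1}=\frac{\tau_k}{2}\min\big\{1,\frac{\|\nabla f(x_{k+1})\|}{\|\nabla f(x_k)\|}\big\}$. If $\nabla f(x_k)=0$ the method stops and returns $x_k$; completed iterations are those carried out before such a stop. *)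

theory Defs
  imports "HOL-Analysis.Analysis"
begin

definition gradient :: "(real^'n \<Rightarrow> real) \<Rightarrow> real^'n \<Rightarrow> real^'n" where
  "gradient f x = (THE D. GDERIV f x :> D)"

definition hessian :: "(real^'n \<Rightarrow> real) \<Rightarrow> real^'n \<Rightarrow> real^'n^'n" where
  "hessian f x = matrix (frechet_derivative (gradient f) (at x))"

definition twice_continuously_differentiable :: "(real^'n \<Rightarrow> real) \<Rightarrow> bool" where
  "twice_continuously_differentiable f \<longleftrightarrow>
     (\<forall>x. f differentiable (at x)) \<and>
     (\<forall>x. gradient f differentiable (at x)) \<and>
     continuous_on UNIV (hessian f)"

text \<open>The library's \<^const>\<open>norm\<close> on matrices is the Frobenius norm; matrix norms below are
  induced operator norms.\<close>

definition op_norm :: "real^'n^'n \<Rightarrow> real" where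
  "op_norm A = onorm (\<lambda>v. A *v v)"

definition pos_def :: "real^'n^'n \<Rightarrow> bool" where
  "pos_def A \<longleftrightarrow> transpose A = A \<and> (\<forall>v. v \<noteq> 0 \<longrightarrow> 0 < v \<bullet> (A *v v))"

definition strongly_convex :: "real \<Rightarrow> (real^'n \<Rightarrow> real) \<Rightarrow> bool" where
  "strongly_convex \<mu> f \<longleftrightarrow>
     (\<forall>x y. f y \<ge> f x + gradient f x \<bullet> (y - x) + \<mu> / 2 * (norm (y - x))\<^sup>2)"

definition global_hessian_smooth :: "real \<Rightarrow> real \<Rightarrow> (real^'n \<Rightarrow> real) \<Rightarrow> bool" where
  "global_hessian_smooth M0 M1 f \<longleftrightarrow>
     (\<forall>x y. op_norm (hessian f y - hessian f x)
              \<le> (M0 + M1 * norm (gradient f x)) * norm (y - x))"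

definition local_hessian_smooth :: "real \<Rightarrow> real \<Rightarrow> real \<Rightarrow> (real^'n \<Rightarrow> real) \<Rightarrow> bool" where
  "local_hessian_smooth \<rho> M0 M1 f \<longleftrightarrow>
     (\<forall>x y. norm (y - x) \<le> \<rho> \<longrightarrow>
        op_norm (hessian f y - hessian f x)
          \<le> (M0 + M1 * norm (gradient f x)) * norm (y - x))"

definition hessian_smooth :: "ereal \<Rightarrow> real \<Rightarrow> real \<Rightarrow> (real^'n \<Rightarrow> real) \<Rightarrow> bool" where
  "hessian_smooth \<rho> M0 M1 f \<longleftrightarrow>
     (\<rho> = \<infinity> \<and> global_hessian_smooth M0 M1 f) \<or>
     (\<exists>r>0. \<rho> = ereal r \<and> local_hessian_smooth r M0 M1 f)"

text \<open>The trial with parameter \<open>\<tau>\<close> at \<open>x\<close> is accepted with step \<open>s\<close>. Positive definiteness makes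
  \<open>s\<close> unique.\<close>

definition trial_accepts ::
  "(real^'n \<Rightarrow> real) \<Rightarrow> (real^'n \<Rightarrow> real^'n^'n) \<Rightarrow> real^'n \<Rightarrow> real \<Rightarrow> real^'n \<Rightarrow> bool" where
  "trial_accepts f H x \<tau> s \<longleftrightarrow>
     pos_def (H x + \<tau> *\<^sub>R mat 1) \<and>
     (H x + \<tau> *\<^sub>R mat 1) *v s = - gradient f x \<and>
     norm (gradient f (x + s) + \<tau> *\<^sub>R s) \<le> \<tau> / 2 * norm s"

text \<open>\<open>ms_backtrack f H x \<tau> y \<sigma>\<close>: the backtracking procedure called with \<open>(x, \<tau>)\<close> terminates and
  returns \<open>(y, \<sigma>)\<close>.\<close>

inductive ms_backtrack ::
  "(real^'n \<Rightarrow> real) \<Rightarrow> (real^'n \<Rightarrow> real^'n^'n) \<Rightarrow> real^'n \<Rightarrow> real \<Rightarrow> real^'n \<Rightarrow> real \<Rightarrow> bool"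
  for f :: "real^'n \<Rightarrow> real" and H :: "real^'n \<Rightarrow> real^'n^'n" and x :: "real^'n" where
  accept: "trial_accepts f H x \<tau> s \<Longrightarrow> ms_backtrack f H x \<tau> (x + s) \<tau>"
| reject: "\<nexists>s. trial_accepts f H x \<tau> s \<Longrightarrow> ms_backtrack f H x (2 * \<tau>) y \<sigma>
             \<Longrightarrow> ms_backtrack f H x \<tau> y \<sigma>"

text \<open>The iterations \<open>0, \<dots>, N - 1\<close> of the method have been completed, with iterates
  \<open>x 0, \<dots>, x N\<close>. The later values of the sequences are irrelevant.\<close>

definition regularized_newton_run ::
  "(real^'n \<Rightarrow> real) \<Rightarrow> (real^'n \<Rightarrow> real^'n^'n) \<Rightarrow> real^'n \<Rightarrow> real \<Rightarrow> nat
     \<Rightarrow> (nat \<Rightarrow> real^'n) \<Rightarrow> (nat \<Rightarrow> real) \<Rightarrow> (nat \<Rightarrow> real) \<Rightarrow> bool" where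
  "regularized_newton_run f H x0 \<eta>0 N x \<eta> \<tau> \<longleftrightarrow>
     x 0 = x0 \<and> \<eta> 0 = \<eta>0 \<and>
     (\<forall>k<N. gradient f (x k) \<noteq> 0 \<and>
        ms_backtrack f H (x k) (\<eta> k) (x (Suc k)) (\<tau> k) \<and>
        \<eta> (Suc k) =
          \<tau> k / 2 * min 1 (norm (gradient f (x (Suc k))) / norm (gradient f (x k))))"

text \<open>In \<^typ>\<open>ereal\<close>, \<open>1 / 0 = \<infinity>\<close> and \<open>a / \<infinity> = 0\<close>, so the cases \<open>M1 = 0\<close> and \<open>\<rho> = \<infinity>\<close> follow
  the usual conventions. For \<open>\<rho> > 0\<close> the radius is positive, so the quotient by its square in
  \<open>tau_bar\<close> is finite and \<^const>\<open>real_of_ereal\<close> is exact there.\<close>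

definition step_radius :: "ereal \<Rightarrow> real \<Rightarrow> ereal" where
  "step_radius \<rho> M1 = min (\<rho> / 2) (1 / (6 * ereal (sqrt M1)))"

text \<open>The argument \<open>\<Delta>\<close> stands for the initial gap \<open>f x0 - f xstar\<close>.\<close>

definition tau_bar :: "real \<Rightarrow> real \<Rightarrow> real \<Rightarrow> real \<Rightarrow> real \<Rightarrow> ereal \<Rightarrow> real \<Rightarrow> real" where
  "tau_bar \<eta>0 \<delta> \<mu> M0 M1 \<rho> \<Delta> =
     Max {\<eta>0, 8 * \<delta> + 48 * M0 * sqrt (2 * \<Delta> / \<mu>),
          real_of_ereal (ereal (2 * \<Delta>) / (step_radius \<rho> M1)\<^sup>2)}"

end

theory Submission
  imports Defs
begin

text \<open>
  Write \<open>g = gradient f\<close>, \<open>\<Delta>(x) = f x - f xstar\<close>, \<open>r\<^sub>0 = step_radius \<rho> M1\<close>, and let \<open>e\<close> be the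
  error of \<open>H\<close> at the current point. An accepted step \<open>s\<close> is an inexact proximal point step:
  \<open>g (x + s)\<close> equals \<open>- \<tau> s\<close> up to an error of norm at most \<open>\<tau> \<parallel>s\<parallel> / 2\<close>. Strong convexity
  applied from \<open>x + s\<close> back to \<open>x\<close>, together with the bound of \<open>\<Delta>(x + s)\<close> by
  \<open>\<parallel>g (x + s)\<parallel>\<^sup>2 / (2 \<mu>)\<close>, turns this into the contraction of the gap
  (\<open>inexact_prox_step_contraction\<close>).

  The remaining point is that backtracking cannot overshoot: every trial with
  \<open>\<tau> \<ge> max (4 e + 24 M0 \<surd>(2 \<Delta>(x) / \<mu>)) (\<Delta>(x) / r\<^sub>0\<^sup>2)\<close> is accepted
  (\<open>large_parameter_accepted\<close>), so a parameter reached by doubling is at most twice this. Two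
  difficulties stand in the way.

  First, \<open>\<parallel>g x\<parallel>\<close> is not controlled by \<open>\<tau>\<close> and the gap, since \<open>\<nabla>\<^sup>2f\<close> need not be
  bounded, and so the smoothness constant \<open>M0 + M1 \<parallel>g x\<parallel>\<close> at the current point is useless. The smoothness condition
  is therefore applied at the new point \<open>z = x + s\<close>. With \<open>q = \<parallel>g z + \<tau> s\<parallel>\<close> one has
  \<open>\<parallel>g z\<parallel> \<le> q + \<tau> \<parallel>s\<parallel>\<close>, and the Taylor estimate becomes an inequality for \<open>q\<close> that bounds itself
  as long as \<open>M1 \<parallel>s\<parallel>\<^sup>2\<close> is small (\<open>short_step_accepted\<close>).

  Secondly, the step must be known to be short. This is a continuity argument in the parameter:
  the step \<open>S \<sigma>\<close> depends continuously on \<open>\<sigma> \<ge> \<tau>\<close> and is short for large \<open>\<sigma>\<close>. Were \<open>S \<tau>\<close> too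
  long, some \<open>S \<sigma>\<close> would have exactly the critical length. That step would be accepted, hence
  decrease \<open>f\<close> by at least \<open>(\<sigma> + \<mu>) / 2 * \<parallel>S \<sigma>\<parallel>\<^sup>2\<close>, which exceeds the available gap
  \<open>\<Delta>(x)\<close> by the choice of the critical length.

  For the bounds on \<open>\<tau> k\<close>, the terms of the threshold other than \<open>e\<close> decay with the gap at
  least like \<open>q\<^sup>k\<close>, where \<open>q = 1 - 2 \<mu> / (3 \<tau>bar + 2 \<mu>)\<close>, and the trial parameter is multiplied
  between iterations by a factor that is at most both \<open>1 / 2\<close> and \<open>q\<close>
  (\<open>next_initial_parameter_le\<close>): the first makes old Hessian errors fade by halves, the second
  propagates the term \<open>\<tau>bar q\<^sup>k\<close>.
\<close>

section \<open>Operator norm and coercive matrices\<close>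

lemma norm_matrix_vector_le_op_norm: "norm (A *v v) \<le> op_norm A * norm v"
  unfolding op_norm_def by (rule onorm[OF matrix_vector_mul_bounded_linear])

lemma op_norm_nonneg: "0 \<le> op_norm A"
  unfolding op_norm_def by (rule onorm_pos_le[OF matrix_vector_mul_bounded_linear])

lemma regularized_matrix_mult: "(A + c *\<^sub>R mat 1) *v v = A *v v + c *\<^sub>R v"
  for A :: "real^'n^'n"
  by (simp add: matrix_vector_mult_add_rdistrib scaleR_matrix_vector_assoc[symmetric])

lemma coercive_norm_bound:
  fixes A :: "real^'n^'n"
  assumes "c * (norm v)\<^sup>2 \<le> v \<bullet> (A *v v)"
  shows "c * norm v \<le> norm (A *v v)"
proof (cases "v = 0")
  case False
  have "c * norm v * norm v \<le> norm (A *v v) * norm v"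
    using assms norm_cauchy_schwarz[of v "A *v v"] by (simp add: power2_eq_square mult_ac)
  then show ?thesis using False by simp
qed simp

lemma coercive_solvable:
  fixes A :: "real^'n^'n"
  assumes c: "c > 0" and coerc: "\<And>v. c * (norm v)\<^sup>2 \<le> v \<bullet> (A *v v)"
  shows "\<exists>s. A *v s = b"
proof -
  have "v = 0" if "A *v v = 0" for v
    using coercive_norm_bound[OF coerc, of v] that c by (simp add: mult_le_0_iff)
  then have "invertible A"
    using matrix_left_invertible_ker invertible_left_inverse by blast
  then show ?thesis
    by (metis invertible_def matrix_vector_mul_assoc matrix_vector_mul_lid)
qed

section \<open>Gradient and Hessian\<close>

lemma has_derivative_gradient:
  assumes "f differentiable (at x)"
  shows "(f has_derivative (\<lambda>h. gradient f x \<bullet> h)) (at x)"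
proof -
  obtain f' where f': "(f has_derivative f') (at x)"
    using assms unfolding differentiable_def by blast
  interpret bounded_linear f' by (rule has_derivative_bounded_linear[OF f'])
  have "f' h = h \<bullet> adjoint f' 1" for h
    using adjoint_works[OF linear_axioms, of h 1] by simp
  then have "f' = (\<lambda>h. h \<bullet> adjoint f' 1)" by blast
  then have 1: "GDERIV f x :> adjoint f' 1"
    unfolding gderiv_def using f' by simp
  have "GDERIV f x :> gradient f x"
    unfolding gradient_def
  proof (rule theI[where P = "\<lambda>D. GDERIV f x :> D", OF 1])
    fix D assume "GDERIV f x :> D"
    then have "(\<lambda>h. h \<bullet> D) = (\<lambda>h. h \<bullet> adjoint f' 1)"
      using 1 unfolding gderiv_def by (rule has_derivative_unique)
    then show "D = adjoint f' 1"
      by (metis inner_commute vector_eq_ldot)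
  qed
  then show ?thesis unfolding gderiv_def by (simp add: inner_commute)
qed

lemma has_derivative_hessian:
  assumes "gradient f differentiable (at x)"
  shows "(gradient f has_derivative (\<lambda>v. hessian f x *v v)) (at x)"
proof -
  have d: "(gradient f has_derivative frechet_derivative (gradient f) (at x)) (at x)"
    using assms frechet_derivative_works by blast
  have "(\<lambda>v. hessian f x *v v) = frechet_derivative (gradient f) (at x)"
    unfolding hessian_def by (rule matrix_vector_mul(2)[OF has_derivative_linear[OF d]])
  then show ?thesis using d by simp
qed

lemma gradient_zero_at_minimizer:
  assumes "f differentiable (at x)" and "\<And>y. f x \<le> f y"
  shows "gradient f x = 0"
proof -
  have "(\<lambda>h. gradient f x \<bullet> h) = (\<lambda>h. 0)"
    by (rule has_derivative_local_min[OF has_derivative_gradient[OF assms(1)]])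
       (use assms(2) in auto)
  then show ?thesis by (metis inner_eq_zero_iff)
qed

lemma strongly_convexD:
  assumes "strongly_convex \<mu> f"
  shows "f x + gradient f x \<bullet> (y - x) + \<mu> / 2 * (norm (y - x))\<^sup>2 \<le> f y"
  using assms unfolding strongly_convex_def by auto

lemma gradient_strongly_monotone:
  assumes "strongly_convex \<mu> f"
  shows "\<mu> * (norm (y - x))\<^sup>2 \<le> (gradient f y - gradient f x) \<bullet> (y - x)"
  using strongly_convexD[OF assms, of x y] strongly_convexD[OF assms, of y x]
  by (simp add: norm_minus_commute inner_diff_left inner_diff_right)

text \<open>Complete the square in the lower quadratic model of \<open>f\<close> at \<open>x\<close>: its minimum is
  \<open>f x - \<parallel>gradient f x\<parallel>\<^sup>2 / (2 \<mu>)\<close>.\<close>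

lemma strongly_convex_gap_le:
  assumes "strongly_convex \<mu> f" and "\<mu> > 0"
  shows "2 * \<mu> * (f x - f y) \<le> (norm (gradient f x))\<^sup>2"
proof -
  let ?g = "gradient f x" and ?d = "y - x"
  have "0 \<le> (norm (?g + \<mu> *\<^sub>R ?d))\<^sup>2" by simp
  also have "\<dots> = (norm ?g)\<^sup>2 + 2 * \<mu> * (?g \<bullet> ?d) + \<mu>\<^sup>2 * (norm ?d)\<^sup>2"
    by (simp only: power2_norm_eq_inner)
       (simp add: inner_add_left inner_add_right inner_commute power2_eq_square)
  finally have *: "0 \<le> (norm ?g)\<^sup>2 + 2 * \<mu> * (?g \<bullet> ?d) + \<mu>\<^sup>2 * (norm ?d)\<^sup>2" .
  have "2 * \<mu> * (f x + ?g \<bullet> ?d + \<mu> / 2 * (norm ?d)\<^sup>2) \<le> 2 * \<mu> * f y"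
    using strongly_convexD[OF assms(1), of x y] assms(2) by simp
  then show ?thesis using * by (simp add: algebra_simps power2_eq_square)
qed

text \<open>The curvature \<open>v \<bullet> \<nabla>\<^sup>2f v\<close> is the limit of difference quotients of the gradient, each of which
  is bounded below by strong monotonicity.\<close>

lemma hessian_coercive:
  assumes sc: "strongly_convex \<mu> f" and diff: "gradient f differentiable (at x)"
  shows "\<mu> * (norm v)\<^sup>2 \<le> v \<bullet> (hessian f x *v v)"
proof -
  let ?\<psi> = "\<lambda>t::real. gradient f (x + t *\<^sub>R v) \<bullet> v"
  have "((\<lambda>t. x + t *\<^sub>R v) has_derivative (\<lambda>t. t *\<^sub>R v)) (at (0::real))"
    by (auto intro!: derivative_eq_intros)
  moreover have "(gradient f has_derivative (\<lambda>u. hessian f x *v u)) (at (x + 0 *\<^sub>R v))"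
    using has_derivative_hessian[OF diff] by simp
  ultimately have "((\<lambda>t. gradient f (x + t *\<^sub>R v)) has_derivative (\<lambda>t. hessian f x *v (t *\<^sub>R v)))
      (at (0::real))"
    by (rule has_derivative_compose)
  then have "(?\<psi> has_derivative (\<lambda>t. (hessian f x *v (t *\<^sub>R v)) \<bullet> v)) (at 0)"
    by (rule has_derivative_inner_left)
  then have "(?\<psi> has_real_derivative v \<bullet> (hessian f x *v v)) (at 0)"
    unfolding has_field_derivative_def
    by (simp add: matrix_vector_mult_scaleR inner_commute mult_commute_abs)
  then have lim: "(\<lambda>t. (?\<psi> t - ?\<psi> 0) / t) \<midarrow>0\<rightarrow> v \<bullet> (hessian f x *v v)"
    unfolding has_field_derivative_iff by simp
  have "\<mu> * (norm v)\<^sup>2 \<le> (?\<psi> t - ?\<psi> 0) / t" if "t \<noteq> 0" for t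
  proof -
    have "\<mu> * (t\<^sup>2 * (norm v)\<^sup>2) \<le> t * (?\<psi> t - ?\<psi> 0)"
      using gradient_strongly_monotone[OF sc, of "x + t *\<^sub>R v" x]
      by (simp add: inner_diff_left power_mult_distrib)
    also have "\<dots> = t\<^sup>2 * ((?\<psi> t - ?\<psi> 0) / t)"
      using that by (simp add: power2_eq_square)
    finally have "t\<^sup>2 * (\<mu> * (norm v)\<^sup>2) \<le> t\<^sup>2 * ((?\<psi> t - ?\<psi> 0) / t)"
      by (simp only: mult.left_commute)
    moreover have "0 < t\<^sup>2" using that by simp
    ultimately show ?thesis by (rule mult_left_le_imp_le)
  qed
  then have "\<forall>\<^sub>F t in at 0. \<mu> * (norm v)\<^sup>2 \<le> (?\<psi> t - ?\<psi> 0) / t"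
    by (auto simp: eventually_at_filter)
  then show ?thesis by (rule tendsto_lowerbound[OF lim]) simp
qed

section \<open>What an accepted step achieves\<close>

text \<open>The hypothesis of the lemmas below is the acceptance test: \<open>x + s\<close> is an approximate
  proximal point of \<open>x\<close> with parameter \<open>\<tau>\<close>. It keeps \<open>- s\<close> close enough to the direction of
  \<open>gradient f (x + s)\<close> that \<open>gradient f (x + s) \<bullet> s \<le> - \<tau> / 2 * \<parallel>s\<parallel>\<^sup>2\<close>.\<close>

lemma inexact_prox_step_decrease:
  assumes sc: "strongly_convex \<mu> f"
    and acc: "norm (gradient f (x + s) + \<tau> *\<^sub>R s) \<le> \<tau> / 2 * norm s" 
  shows "(\<tau> + \<mu>) / 2 * (norm s)\<^sup>2 \<le> f x - f (x + s)"
proof -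
  let ?g = "gradient f (x + s)"
  have "(?g + \<tau> *\<^sub>R s) \<bullet> s \<le> norm (?g + \<tau> *\<^sub>R s) * norm s" by (rule norm_cauchy_schwarz)
  also have "\<dots> \<le> \<tau> / 2 * norm s * norm s" using mult_right_mono[OF acc norm_ge_zero[of s]] .
  finally have "?g \<bullet> s \<le> - (\<tau> / 2 * (norm s)\<^sup>2)"
    by (simp add: inner_add_left dot_square_norm power2_eq_square algebra_simps)
  then show ?thesis
    using strongly_convexD[OF sc, of "x + s" x] by (simp add: algebra_simps add_divide_distrib)
qed

text \<open>Squaring the test gives both a multiple of \<open>\<parallel>g\<parallel>\<^sup>2\<close> and one of \<open>\<parallel>s\<parallel>\<^sup>2\<close> in the decrease, where
  \<open>g = gradient f (x + s)\<close>. Since \<open>\<parallel>g\<parallel> \<le> 3 / 2 * \<tau> \<parallel>s\<parallel>\<close>, the decrease is at least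
  \<open>\<parallel>g\<parallel>\<^sup>2 (2 / (3 \<tau>) + 2 \<mu> / (9 \<tau>\<^sup>2))\<close>, and \<open>\<parallel>g\<parallel>\<^sup>2 \<ge> 2 \<mu> (f (x + s) - f y)\<close>. The resulting factor
  \<open>1 + 4 \<mu> / (3 \<tau>) + 4 \<mu>\<^sup>2 / (9 \<tau>\<^sup>2)\<close> is the perfect square \<open>(1 + 2 \<mu> / (3 \<tau>))\<^sup>2\<close>.\<close>

lemma inexact_prox_step_contraction:
  assumes sc: "strongly_convex \<mu> f" and \<mu>: "\<mu> > 0" and \<tau>: "\<tau> > 0"
    and acc: "norm (gradient f (x + s) + \<tau> *\<^sub>R s) \<le> \<tau> / 2 * norm s"
  shows "f (x + s) - f y \<le> (1 - 2 * \<mu> / (3 * \<tau> + 2 * \<mu>))\<^sup>2 * (f x - f y)"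
proof -
  let ?g = "gradient f (x + s)" and ?n = "norm s" and ?G = "norm (gradient f (x + s))"
  define d where "d = ?g \<bullet> s"
  have "(norm (?g + \<tau> *\<^sub>R s))\<^sup>2 \<le> (\<tau> / 2 * ?n)\<^sup>2" using acc by (simp add: power_mono)
  moreover have "(norm (?g + \<tau> *\<^sub>R s))\<^sup>2 = ?G\<^sup>2 + 2 * \<tau> * d + \<tau>\<^sup>2 * ?n\<^sup>2"
    unfolding d_def by (simp only: power2_norm_eq_inner)
       (simp add: inner_add_left inner_add_right inner_commute power2_eq_square)
  ultimately have 1: "?G\<^sup>2 + 2 * \<tau> * d + 3 / 4 * \<tau>\<^sup>2 * ?n\<^sup>2 \<le> 0"
    by (simp add: power_mult_distrib power_divide)
  have "?G \<le> norm (?g + \<tau> *\<^sub>R s) + norm (\<tau> *\<^sub>R s)"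
    using norm_triangle_ineq4[of "?g + \<tau> *\<^sub>R s" "\<tau> *\<^sub>R s"] by simp
  then have "?G \<le> 3 / 2 * \<tau> * ?n" using acc \<tau> by simp
  then have "?G\<^sup>2 \<le> (3 / 2 * \<tau> * ?n)\<^sup>2" by (rule power_mono) simp
  then have 2: "?G\<^sup>2 \<le> 9 / 4 * \<tau>\<^sup>2 * ?n\<^sup>2" by (simp add: power_mult_distrib power_divide)
  have 3: "f (x + s) - d + \<mu> / 2 * ?n\<^sup>2 \<le> f x"
    using strongly_convexD[OF sc, of "x + s" x] unfolding d_def by simp
  define a where "a = f (x + s) - f y"
  define b where "b = f x - f y"
  have 4: "2 * \<mu> * a \<le> ?G\<^sup>2"
    using strongly_convex_gap_le[OF sc \<mu>] unfolding a_def by simp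
  have "(3 * \<tau> + 2 * \<mu>)\<^sup>2 * a \<le> (3 * \<tau>)\<^sup>2 * b"
  proof -
    have b: "a - d + \<mu> / 2 * ?n\<^sup>2 \<le> b" using 3 by (simp add: a_def b_def)
    \<comment> \<open>Linear elimination of \<open>d\<close>, \<open>?n\<close> and \<open>?G\<close>, with all denominators cleared.\<close>
    have "18 * \<tau>\<^sup>2 * (a - d + \<mu> / 2 * ?n\<^sup>2) \<le> 18 * \<tau>\<^sup>2 * b"
      using b by (rule mult_left_mono) simp
    moreover have "9 * \<tau> * (?G\<^sup>2 + 2 * \<tau> * d + 3 / 4 * \<tau>\<^sup>2 * ?n\<^sup>2) \<le> 0"
      using 1 \<tau> by (simp add: mult_le_0_iff)
    moreover have "(3 * \<tau> + 4 * \<mu>) * ?G\<^sup>2 \<le> (3 * \<tau> + 4 * \<mu>) * (9 / 4 * \<tau>\<^sup>2 * ?n\<^sup>2)"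
      using 2 \<tau> \<mu> by (intro mult_left_mono) auto
    moreover have "(12 * \<tau> + 4 * \<mu>) * (2 * \<mu> * a) \<le> (12 * \<tau> + 4 * \<mu>) * ?G\<^sup>2"
      using 4 \<tau> \<mu> by (intro mult_left_mono) auto
    ultimately show ?thesis by (simp add: algebra_simps power2_eq_square)
  qed
  then have "a \<le> (3 * \<tau>)\<^sup>2 * b / (3 * \<tau> + 2 * \<mu>)\<^sup>2"
    using \<tau> \<mu> by (subst pos_le_divide_eq) (auto simp: mult.commute)
  also have "\<dots> = (3 * \<tau> / (3 * \<tau> + 2 * \<mu>))\<^sup>2 * b" by (simp add: power_divide)
  also have "3 * \<tau> / (3 * \<tau> + 2 * \<mu>) = 1 - 2 * \<mu> / (3 * \<tau> + 2 * \<mu>)"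
    using \<tau> \<mu> by (simp add: field_simps)
  finally show ?thesis unfolding a_def b_def .
qed

text \<open>Strong monotonicity bounds the old gradient below by \<open>(\<mu> + \<tau> / 2) \<parallel>s\<parallel>\<close>, while the test bounds
  the new one above by \<open>3 / 2 * \<tau> \<parallel>s\<parallel>\<close>. So the gradient shrinks fast when \<open>\<tau>\<close> is small compared
  with \<open>\<mu>\<close>.\<close>

lemma inexact_prox_step_gradient_ratio:
  assumes sc: "strongly_convex \<mu> f" and \<mu>: "\<mu> > 0" and \<tau>: "\<tau> > 0"
    and acc: "norm (gradient f (x + s) + \<tau> *\<^sub>R s) \<le> \<tau> / 2 * norm s"
  shows "(2 * \<mu> + \<tau>) * norm (gradient f (x + s)) \<le> 3 * \<tau> * norm (gradient f x)"
proof (cases "s = 0")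
  case True
  then show ?thesis using acc by (simp add: \<tau> less_imp_le)
next
  case False
  let ?g = "gradient f (x + s)"
  have "- ((?g + \<tau> *\<^sub>R s) \<bullet> s) \<ge> - (norm (?g + \<tau> *\<^sub>R s) * norm s)"
    using norm_cauchy_schwarz by simp
  moreover have "norm (?g + \<tau> *\<^sub>R s) * norm s \<le> \<tau> / 2 * norm s * norm s"
    using mult_right_mono[OF acc norm_ge_zero[of s]] .
  ultimately have "?g \<bullet> s + \<tau> * (norm s)\<^sup>2 \<le> \<tau> / 2 * (norm s)\<^sup>2"
    by (simp add: inner_add_left dot_square_norm power2_eq_square)
  moreover have "\<mu> * (norm s)\<^sup>2 \<le> ?g \<bullet> s - gradient f x \<bullet> s"
    using gradient_strongly_monotone[OF sc, of "x + s" x] by (simp add: inner_diff_left)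
  moreover have "- (gradient f x \<bullet> s) \<le> norm (gradient f x) * norm s"
    using norm_cauchy_schwarz[of "- gradient f x" s] by simp
  ultimately have "((\<mu> + \<tau> / 2) * norm s) * norm s \<le> norm (gradient f x) * norm s"
    by (simp add: algebra_simps power2_eq_square)
  then have G: "(\<mu> + \<tau> / 2) * norm s \<le> norm (gradient f x)" using False by simp
  have "norm ?g \<le> norm (?g + \<tau> *\<^sub>R s) + norm (\<tau> *\<^sub>R s)"
    using norm_triangle_ineq4[of "?g + \<tau> *\<^sub>R s" "\<tau> *\<^sub>R s"] by simp
  then have "norm ?g \<le> 3 / 2 * \<tau> * norm s" using acc \<tau> by simp
  then have "(2 * \<mu> + \<tau>) * norm ?g \<le> (2 * \<mu> + \<tau>) * (3 / 2 * \<tau> * norm s)"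
    using \<mu> \<tau> by (intro mult_left_mono) auto
  also have "\<dots> = 3 * \<tau> * ((\<mu> + \<tau> / 2) * norm s)" by (simp add: algebra_simps)
  also have "\<dots> \<le> 3 * \<tau> * norm (gradient f x)" using G \<tau> by (intro mult_left_mono) auto
  finally show ?thesis .
qed


section \<open>Short trial steps are accepted\<close>

text \<open>The Hessians are compared with the one at the endpoint \<open>z\<close>, so that \<open>L\<close> may involve the
  gradient at \<open>z\<close> only. One half of the bound is the mean value inequality for
  \<open>gradient f y - hessian f z *v y\<close>, the other half replaces \<open>hessian f z\<close> by \<open>hessian f x\<close>.\<close>

lemma gradient_taylor_at_endpoint:
  fixes f :: "real^'n \<Rightarrow> real"
  assumes diff: "\<And>y. gradient f differentiable (at y)" and L: "0 \<le> L"
    and smooth: "\<And>y. norm (y - z) \<le> norm (z - x)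
      \<Longrightarrow> op_norm (hessian f y - hessian f z) \<le> L * norm (y - z)"
  shows "norm (gradient f z - gradient f x - hessian f x *v (z - x)) \<le> 2 * L * (norm (z - x))\<^sup>2"
proof -
  let ?n = "norm (z - x)" and ?A = "hessian f z"
  define F where "F y = gradient f y - ?A *v y" for y
  have "norm (F z - F x) \<le> L * ?n * norm (z - x)"
  proof (rule differentiable_bound[of "closed_segment x z" F "\<lambda>y v. hessian f y *v v - ?A *v v"])
    fix y assume y: "y \<in> closed_segment x z"
    show "(F has_derivative (\<lambda>v. hessian f y *v v - ?A *v v)) (at y within closed_segment x z)"
      unfolding F_def
      by (intro has_derivative_diff has_derivative_at_withinI[OF has_derivative_hessian[OF diff]]
          bounded_linear_imp_has_derivative matrix_vector_mul_bounded_linear)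
    have "norm (y - z) \<le> ?n"
      using segment_bound(2)[OF y] by (simp add: norm_minus_commute)
    then have "op_norm (hessian f y - ?A) \<le> L * ?n"
      using smooth[of y] L by (meson mult_left_mono order_trans)
    moreover have "(\<lambda>v. hessian f y *v v - ?A *v v) = (\<lambda>v. (hessian f y - ?A) *v v)"
      by (simp add: matrix_vector_mult_diff_rdistrib)
    ultimately show "onorm (\<lambda>v. hessian f y *v v - ?A *v v) \<le> L * ?n"
      unfolding op_norm_def by (simp only:)
  qed auto
  moreover have "F z - F x = gradient f z - gradient f x - ?A *v (z - x)"
    by (simp add: F_def matrix_vector_mult_diff_distrib)
  ultimately have 1: "norm (gradient f z - gradient f x - ?A *v (z - x)) \<le> L * ?n\<^sup>2"
    by (simp add: power2_eq_square mult.assoc)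
  have "op_norm (hessian f x - ?A) \<le> L * ?n"
    using smooth[of x] by (simp add: norm_minus_commute)
  then have "op_norm (hessian f x - ?A) * ?n \<le> L * ?n * ?n"
    by (rule mult_right_mono) simp
  then have 2: "norm ((hessian f x - ?A) *v (z - x)) \<le> L * ?n\<^sup>2"
    using norm_matrix_vector_le_op_norm[of "hessian f x - ?A" "z - x"]
    by (simp add: power2_eq_square mult.assoc)
  have split: "gradient f z - gradient f x - hessian f x *v (z - x)
      = (gradient f z - gradient f x - ?A *v (z - x)) - (hessian f x - ?A) *v (z - x)"
    by (simp add: matrix_vector_mult_diff_rdistrib)
  show ?thesis
    unfolding split
    using norm_triangle_ineq4[of "gradient f z - gradient f x - ?A *v (z - x)"
        "(hessian f x - ?A) *v (z - x)"] 1 2 by linarith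
qed

text \<open>Both smoothness conditions in one form, with \<open>\<kappa>\<close> in the role of \<open>1 / r\<^sub>0\<^sup>2\<close>, which is \<open>0\<close> for an
  infinite radius. The premise says that the distance is at most \<open>\<surd>2 r\<^sub>0\<close> rather than \<open>r\<^sub>0\<close>: this
  is the length that the threshold \<open>\<tau> \<ge> \<kappa> \<Delta>\<close> yields, as an accepted step only guarantees
  \<open>\<tau> / 2 * \<parallel>s\<parallel>\<^sup>2 \<le> \<Delta>\<close>. It still lies within \<open>\<rho>\<close>.\<close>

definition steps_controlled :: "real \<Rightarrow> real \<Rightarrow> real \<Rightarrow> (real^'n \<Rightarrow> real) \<Rightarrow> bool" where
  "steps_controlled \<kappa> M0 M1 f \<longleftrightarrow>
     (\<forall>a b. \<kappa> * (norm (b - a))\<^sup>2 \<le> 2 \<longrightarrow>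
        M1 * (norm (b - a))\<^sup>2 \<le> 1 / 18 \<and>
        op_norm (hessian f b - hessian f a) \<le> (M0 + M1 * norm (gradient f a)) * norm (b - a))"

locale regularized_newton =
  fixes f :: "real^'n \<Rightarrow> real" and H :: "real^'n \<Rightarrow> real^'n^'n" and xstar :: "real^'n"
    and \<mu> M0 M1 \<kappa> :: real
  assumes mu_pos: "\<mu> > 0"
    and convex: "strongly_convex \<mu> f"
    and f_diff: "\<And>y. f differentiable (at y)"
    and gradient_diff: "\<And>y. gradient f differentiable (at y)"
    and minimizer: "\<And>y. f xstar \<le> f y"
    and H_symmetric: "\<And>y. transpose (H y) = H y"
    and M0_nonneg: "M0 \<ge> 0" and M1_nonneg: "M1 \<ge> 0" and kappa_nonneg: "\<kappa> \<ge> 0"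
    and steps_controlled: "steps_controlled \<kappa> M0 M1 f"
begin

definition gap :: "real^'n \<Rightarrow> real" where
  "gap y = f y - f xstar"

definition hessian_error :: "real^'n \<Rightarrow> real" where
  "hessian_error y = op_norm (H y - hessian f y)"

lemma gap_nonneg: "0 \<le> gap y"
  using minimizer[of y] by (simp add: gap_def)

lemma gap_pos: "gradient f y \<noteq> 0 \<Longrightarrow> 0 < gap y"
  using gradient_zero_at_minimizer[OF f_diff, of y] minimizer
  unfolding gap_def by (metis antisym_conv2 diff_gt_0_iff_gt order_trans)

lemma hessian_error_nonneg: "0 \<le> hessian_error y"
  unfolding hessian_error_def by (rule op_norm_nonneg)

text \<open>Replacing \<open>\<nabla>\<^sup>2f\<close> by \<open>H\<close> costs at most \<open>hessian_error y\<close> of curvature, which the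
  regularization pays for.\<close>

lemma regularized_coercive:
  assumes "hessian_error y \<le> \<tau>"
  shows "\<mu> * (norm v)\<^sup>2 + (\<tau> - hessian_error y) * (norm v)\<^sup>2 \<le> v \<bullet> ((H y + \<tau> *\<^sub>R mat 1) *v v)"
proof -
  let ?E = "H y - hessian f y"
  have "- (v \<bullet> (?E *v v)) \<le> norm v * norm (?E *v v)"
    using norm_cauchy_schwarz[of "- v" "?E *v v"] by simp
  also have "\<dots> \<le> norm v * (hessian_error y * norm v)"
    unfolding hessian_error_def
    by (intro mult_left_mono norm_matrix_vector_le_op_norm norm_ge_zero)
  finally have "- (v \<bullet> (?E *v v)) \<le> hessian_error y * (norm v)\<^sup>2"
    by (simp add: power2_eq_square mult_ac)
  moreover have "\<mu> * (norm v)\<^sup>2 \<le> v \<bullet> (hessian f y *v v)"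
    by (rule hessian_coercive[OF convex gradient_diff])
  moreover have "v \<bullet> ((H y + \<tau> *\<^sub>R mat 1) *v v)
      = v \<bullet> (?E *v v) + v \<bullet> (hessian f y *v v) + \<tau> * (norm v)\<^sup>2"
    by (simp add: regularized_matrix_mult inner_add_right matrix_vector_mult_diff_rdistrib
        dot_square_norm inner_diff_right)
  ultimately show ?thesis by (simp add: algebra_simps)
qed

lemma regularized_pos_def:
  assumes "hessian_error y \<le> \<tau>"
  shows "pos_def (H y + \<tau> *\<^sub>R mat 1)"
proof -
  have "transpose (H y + \<tau> *\<^sub>R mat 1) = H y + \<tau> *\<^sub>R mat 1"
    using H_symmetric[of y] by (simp add: vec_eq_iff transpose_def mat_def)
  moreover have "0 < v \<bullet> ((H y + \<tau> *\<^sub>R mat 1) *v v)" if "v \<noteq> 0" for v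
  proof -
    have "0 < \<mu> * (norm v)\<^sup>2" "0 \<le> (\<tau> - hessian_error y) * (norm v)\<^sup>2"
      using that mu_pos assms by auto
    then show ?thesis using regularized_coercive[OF assms, of v] by linarith
  qed
  ultimately show ?thesis unfolding pos_def_def by blast
qed

lemma regularized_norm_bound:
  assumes "hessian_error y \<le> \<tau>"
  shows "(\<mu> + \<tau> - hessian_error y) * norm v \<le> norm ((H y + \<tau> *\<^sub>R mat 1) *v v)"
  using regularized_coercive[OF assms, of v]
  by (intro coercive_norm_bound) (simp add: algebra_simps)

lemma regularized_solvable:
  assumes "hessian_error y \<le> \<tau>"
  shows "\<exists>s. (H y + \<tau> *\<^sub>R mat 1) *v s = b"
proof (rule coercive_solvable[OF mu_pos])
  fix v :: "real^'n"
  have "0 \<le> (\<tau> - hessian_error y) * (norm v)\<^sup>2" using assms by simp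
  then show "\<mu> * (norm v)\<^sup>2 \<le> v \<bullet> ((H y + \<tau> *\<^sub>R mat 1) *v v)"
    using regularized_coercive[OF assms, of v] by linarith
qed

text \<open>The Newton equation cancels the linear part of \<open>gradient f (y + s) + \<tau> s\<close>, and what remains is
  the Hessian error and a Taylor remainder proportional to \<open>M0 + M1 \<parallel>gradient f (y + s)\<parallel>\<close>. As
  \<open>\<parallel>gradient f (y + s)\<parallel> \<le> q + \<tau> \<parallel>s\<parallel>\<close>, where \<open>q\<close> is the quantity to be bounded, and
  \<open>2 M1 \<parallel>s\<parallel>\<^sup>2 \<le> 1 / 9\<close>, the unknown \<open>q\<close> can be absorbed on the left:
  \<open>8 / 9 * q \<le> (1 / 3 + 1 / 9) \<tau> \<parallel>s\<parallel>\<close>.\<close>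

lemma short_step_accepted:
  assumes s: "(H y + \<tau> *\<^sub>R mat 1) *v s = - gradient f y"
    and short: "\<kappa> * (norm s)\<^sup>2 \<le> 2"
    and \<tau>: "hessian_error y + 2 * M0 * norm s \<le> \<tau> / 3"
  shows "norm (gradient f (y + s) + \<tau> *\<^sub>R s) \<le> \<tau> / 2 * norm s"
proof -
  let ?g = "gradient f (y + s)" and ?n = "norm s"
  define q where "q = norm (?g + \<tau> *\<^sub>R s)"
  define L where "L = M0 + M1 * norm ?g"
  have "0 \<le> 2 * M0 * ?n" using M0_nonneg by simp
  then have \<tau>_nonneg: "0 \<le> \<tau>" using \<tau> hessian_error_nonneg[of y] by linarith
  have "norm (?g - gradient f y - hessian f y *v (y + s - y)) \<le> 2 * L * (norm (y + s - y))\<^sup>2"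
  proof (rule gradient_taylor_at_endpoint[OF gradient_diff])
    show "0 \<le> L" unfolding L_def using M0_nonneg M1_nonneg by simp
    fix w assume "norm (w - (y + s)) \<le> norm (y + s - y)"
    then have "(norm (w - (y + s)))\<^sup>2 \<le> ?n\<^sup>2" by (intro power_mono) auto
    then have "\<kappa> * (norm (w - (y + s)))\<^sup>2 \<le> 2"
      using short kappa_nonneg by (meson mult_left_mono order_trans)
    then show "op_norm (hessian f w - hessian f (y + s)) \<le> L * norm (w - (y + s))"
      using steps_controlled unfolding steps_controlled_def L_def by blast
  qed
  then have 1: "norm (?g - gradient f y - hessian f y *v s) \<le> 2 * L * ?n\<^sup>2" by simp
  have "H y *v s + \<tau> *\<^sub>R s = - gradient f y" using s by (simp add: regularized_matrix_mult)
  then have split: "?g + \<tau> *\<^sub>R s = (?g - gradient f y - hessian f y *v s) - (H y - hessian f y) *v s"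
    by (simp add: matrix_vector_mult_diff_rdistrib algebra_simps)
  have "q \<le> 2 * L * ?n\<^sup>2 + hessian_error y * ?n"
    using 1 norm_matrix_vector_le_op_norm[of "H y - hessian f y" s]
      norm_triangle_ineq4[of "?g - gradient f y - hessian f y *v s" "(H y - hessian f y) *v s"]
    unfolding q_def hessian_error_def split by linarith
  then have 2: "q \<le> (hessian_error y + 2 * M0 * ?n) * ?n + 2 * (M1 * ?n\<^sup>2) * norm ?g"
    by (simp add: L_def algebra_simps power2_eq_square)
  have "norm ?g \<le> q + norm (\<tau> *\<^sub>R s)"
    using norm_triangle_ineq4[of "?g + \<tau> *\<^sub>R s" "\<tau> *\<^sub>R s"] by (simp add: q_def)
  then have 3: "norm ?g \<le> q + \<tau> * ?n" using \<tau>_nonneg by simp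
  have "M1 * (norm (y + s - y))\<^sup>2 \<le> 1 / 18"
    using steps_controlled short unfolding steps_controlled_def
    by (metis add_diff_cancel_left')
  then have "2 * (M1 * ?n\<^sup>2) * norm ?g \<le> 1 / 9 * (q + \<tau> * ?n)"
    using 3 M1_nonneg by (intro mult_mono) auto
  moreover have "(hessian_error y + 2 * M0 * ?n) * ?n \<le> \<tau> / 3 * ?n"
    using \<tau> by (intro mult_right_mono) auto
  ultimately have "q \<le> \<tau> / 3 * ?n + 1 / 9 * (q + \<tau> * ?n)" using 2 by linarith
  then show ?thesis unfolding q_def[symmetric] by (simp add: field_simps)
qed

text \<open>By \<open>short_step_accepted\<close> it suffices that the step has length at most
  \<open>R = min (\<surd>(2 \<Delta> / \<mu>)) (\<surd>(2 / \<kappa>))\<close>. No step with a parameter \<open>\<sigma> \<ge> \<tau>\<close> has length exactly \<open>R\<close>,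
  because it would be accepted and decrease \<open>f\<close> by more than \<open>\<Delta>\<close>. The length varies continuously
  with \<open>\<sigma>\<close> and tends to \<open>0\<close>, so it is below \<open>R\<close> throughout.\<close>

lemma large_parameter_accepted:
  assumes g: "gradient f y \<noteq> 0" and \<tau>: "\<tau> > 0"
    and \<tau>1: "4 * hessian_error y + 24 * M0 * sqrt (2 * gap y / \<mu>) \<le> \<tau>"
    and \<tau>2: "\<kappa> * gap y \<le> \<tau>"
  shows "\<exists>s. trial_accepts f H y \<tau> s"
proof -
  let ?e = "hessian_error y" and ?\<Delta> = "gap y"
  define D where "D = sqrt (2 * ?\<Delta> / \<mu>)"
  \<comment> \<open>\<open>C\<close> stands for \<open>1 / R\<^sup>2\<close>: as a maximum it needs no separate treatment of \<open>\<kappa> = 0\<close>.\<close>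
  define C where "C = max (\<mu> / (2 * ?\<Delta>)) (\<kappa> / 2)"
  define R where "R = 1 / sqrt C"
  have \<Delta>: "?\<Delta> > 0" using gap_pos[OF g] .
  have C: "C > 0" unfolding C_def using \<Delta> mu_pos by (simp add: less_max_iff_disj)
  then have R: "R > 0" by (simp add: R_def)
  have D: "0 \<le> D" unfolding D_def using \<Delta> mu_pos by simp
  have MD: "0 \<le> M0 * D" using D M0_nonneg by simp
  have e: "?e \<le> \<tau>" using \<tau>1 MD hessian_error_nonneg[of y] unfolding D_def[symmetric] by linarith
  have accept: "norm (gradient f (y + s) + \<sigma> *\<^sub>R s) \<le> \<sigma> / 2 * norm s"
    if \<sigma>: "\<tau> \<le> \<sigma>" and s: "(H y + \<sigma> *\<^sub>R mat 1) *v s = - gradient f y" and sR: "norm s \<le> R" for \<sigma> s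
  proof (rule short_step_accepted[OF s])
    have "(norm s)\<^sup>2 \<le> R\<^sup>2" using sR by (rule power_mono) simp
    also have "\<dots> = 1 / C" using C by (simp add: R_def power_divide)
    finally have CS: "C * (norm s)\<^sup>2 \<le> 1" using C by (simp add: field_simps)
    have "\<kappa> / 2 * (norm s)\<^sup>2 \<le> C * (norm s)\<^sup>2" by (intro mult_right_mono) (auto simp: C_def)
    then show "\<kappa> * (norm s)\<^sup>2 \<le> 2" using CS by simp
    have "\<mu> / (2 * ?\<Delta>) * (norm s)\<^sup>2 \<le> C * (norm s)\<^sup>2" by (intro mult_right_mono) (auto simp: C_def)
    then have "\<mu> / (2 * ?\<Delta>) * (norm s)\<^sup>2 \<le> 1" using CS by linarith
    then have "(norm s)\<^sup>2 \<le> 2 * ?\<Delta> / \<mu>" using \<Delta> mu_pos by (simp add: field_simps)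
    then have "norm s \<le> D" unfolding D_def by (rule real_le_rsqrt)
    then have "M0 * norm s \<le> M0 * D" using M0_nonneg by (rule mult_left_mono)
    then show "?e + 2 * M0 * norm s \<le> \<sigma> / 3"
      using \<tau>1 \<sigma> \<tau> MD unfolding D_def[symmetric] by linarith
  qed
  have inside: "norm s \<noteq> R"
    if \<sigma>: "\<tau> \<le> \<sigma>" and s: "(H y + \<sigma> *\<^sub>R mat 1) *v s = - gradient f y" for \<sigma> s
  proof
    assume sR: "norm s = R"
    have "(\<sigma> + \<mu>) / 2 * (norm s)\<^sup>2 \<le> f y - f (y + s)"
      by (rule inexact_prox_step_decrease[OF convex accept[OF \<sigma> s]]) (simp add: sR)
    then have dec: "(\<sigma> + \<mu>) / 2 * R\<^sup>2 \<le> ?\<Delta>"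
      using minimizer[of "y + s"] sR by (simp add: gap_def)
    \<comment> \<open>The summand \<open>\<mu>\<close> accounts for one entry of the maximum \<open>C\<close> and \<open>\<sigma>\<close> for the other; in
      each case the remaining summand makes the inequality strict.\<close>
    have "\<mu> / (2 * ?\<Delta>) * ?\<Delta> < (\<sigma> + \<mu>) / 2"
      using \<Delta> \<sigma> \<tau> by simp
    moreover have "\<kappa> / 2 * ?\<Delta> < (\<sigma> + \<mu>) / 2"
      using \<tau>2 \<sigma> mu_pos by simp
    ultimately have "C * ?\<Delta> < (\<sigma> + \<mu>) / 2" unfolding C_def by (simp add: max_def)
    then have "?\<Delta> < (\<sigma> + \<mu>) / 2 / C"
      using C by (simp only: pos_less_divide_eq mult.commute)
    also have "\<dots> = (\<sigma> + \<mu>) / 2 * R\<^sup>2"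
      using C by (simp add: R_def power_divide)
    finally show False using dec by linarith
  qed
  define S where "S \<sigma> = (SOME s. (H y + \<sigma> *\<^sub>R mat 1) *v s = - gradient f y)" for \<sigma>
  have S: "(H y + \<sigma> *\<^sub>R mat 1) *v S \<sigma> = - gradient f y" if "\<tau> \<le> \<sigma>" for \<sigma>
    unfolding S_def by (rule someI_ex[OF regularized_solvable[OF order_trans[OF e that]]])
  have S_bound: "(\<mu> + \<sigma> - ?e) * norm (S \<sigma>) \<le> norm (gradient f y)" if "\<tau> \<le> \<sigma>" for \<sigma>
    using regularized_norm_bound[OF order_trans[OF e that], of "S \<sigma>"] unfolding S[OF that] by simp
  have S_bound': "norm (S \<sigma>) \<le> norm (gradient f y) / \<mu>" if "\<tau> \<le> \<sigma>" for \<sigma>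
  proof -
    have "\<mu> * norm (S \<sigma>) \<le> (\<mu> + \<sigma> - ?e) * norm (S \<sigma>)"
      using e that by (intro mult_right_mono) auto
    then show ?thesis using S_bound[OF that] mu_pos by (simp add: field_simps)
  qed
  \<comment> \<open>Continuity from the resolvent identity \<open>(H y + a) (S a - S b) = (b - a) S b\<close>.\<close>
  have "lipschitz_on (norm (gradient f y) / \<mu> / \<mu>) {\<tau>..} S"
  proof (rule lipschitz_onI)
    fix a b assume ab: "a \<in> {\<tau>..}" "b \<in> {\<tau>..}"
    have "H y *v S a + a *\<^sub>R S a = H y *v S b + b *\<^sub>R S b"
      using S[of a] S[of b] ab by (simp add: regularized_matrix_mult)
    then have "(H y + a *\<^sub>R mat 1) *v (S a - S b) = (b - a) *\<^sub>R S b"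
      unfolding regularized_matrix_mult matrix_vector_mult_diff_distrib
      by (simp add: algebra_simps)
    moreover have "?e \<le> a" using e ab by simp
    ultimately have "(\<mu> + a - ?e) * norm (S a - S b) \<le> \<bar>b - a\<bar> * norm (S b)"
      using regularized_norm_bound[of y a "S a - S b"] by (simp only: norm_scaleR)
    also have "\<dots> \<le> \<bar>b - a\<bar> * (norm (gradient f y) / \<mu>)"
      using S_bound'[of b] ab by (intro mult_left_mono) auto
    finally have "(\<mu> + a - ?e) * norm (S a - S b) \<le> \<bar>b - a\<bar> * (norm (gradient f y) / \<mu>)" .
    moreover have "\<mu> * norm (S a - S b) \<le> (\<mu> + a - ?e) * norm (S a - S b)"
      using e ab by (intro mult_right_mono) auto
    ultimately have "\<mu> * norm (S a - S b) \<le> \<bar>b - a\<bar> * (norm (gradient f y) / \<mu>)" by linarith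
    then show "dist (S a) (S b) \<le> norm (gradient f y) / \<mu> / \<mu> * dist a b"
      using mu_pos by (simp add: dist_norm field_simps abs_minus_commute)
  qed (use mu_pos in simp)
  then have cont: "continuous_on {\<tau>..} (\<lambda>\<sigma>. norm (S \<sigma>))"
    by (intro continuous_on_norm lipschitz_on_continuous_on)
  define T where "T = \<tau> + norm (gradient f y) / R"
  have T: "\<tau> \<le> T" unfolding T_def using R by simp
  have T_end: "norm (S T) \<le> R"
  proof (rule ccontr)
    assume *: "\<not> norm (S T) \<le> R"
    have "norm (gradient f y) = norm (gradient f y) / R * R" using R by simp
    also have "\<dots> \<le> (\<mu> + T - ?e) * R"
      unfolding T_def using R e mu_pos by (intro mult_right_mono) auto
    also have "\<dots> < (\<mu> + T - ?e) * norm (S T)"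
      using * e mu_pos T by (intro mult_strict_left_mono) auto
    finally show False using S_bound[OF T] by simp
  qed
  have "norm (S \<tau>) \<le> R"
  proof (rule ccontr)
    assume "\<not> norm (S \<tau>) \<le> R"
    then obtain \<sigma> where "\<tau> \<le> \<sigma>" "\<sigma> \<le> T" "norm (S \<sigma>) = R"
      using IVT2'[of "\<lambda>\<sigma>. norm (S \<sigma>)" T R \<tau>] T T_end continuous_on_subset[OF cont, of "{\<tau>..T}"]
      by auto
    then show False using inside[OF _ S] by blast
  qed
  then have "trial_accepts f H y \<tau> (S \<tau>)"
    unfolding trial_accepts_def using accept[OF _ S] S regularized_pos_def[OF e] by simp
  then show ?thesis ..
qed


end

section \<open>Backtracking and the iterations\<close>

lemma ms_backtrack_result:
  assumes "ms_backtrack f H y \<tau> z \<sigma>" and "\<tau> > 0"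
    and "\<And>t. t > 0 \<Longrightarrow> B \<le> t \<Longrightarrow> \<exists>s. trial_accepts f H y t s"
  shows "\<sigma> > 0 \<and> \<sigma> \<le> max \<tau> (2 * B) \<and> (\<exists>s. z = y + s \<and> trial_accepts f H y \<sigma> s)"
  using assms
proof (induction rule: ms_backtrack.induct)
  case (accept \<tau> s)
  then show ?case by auto
next
  case (reject \<tau> z \<sigma>)
  have "\<tau> < B" using reject by (meson not_le)
  then show ?case using reject.IH reject.prems by auto
qed

context regularized_newton
begin

lemma iteration_bounds:
  assumes g: "gradient f y \<noteq> 0" and \<eta>: "\<eta> > 0" and bt: "ms_backtrack f H y \<eta> z \<tau>"
  shows "\<tau> > 0"
    and "\<tau> \<le> max \<eta> (max (8 * hessian_error y + 48 * M0 * sqrt (2 * gap y / \<mu>)) (2 * gap y * \<kappa>))"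
    and "gap z \<le> (1 - 2 * \<mu> / (3 * \<tau> + 2 * \<mu>))\<^sup>2 * gap y"
    and "(2 * \<mu> + \<tau>) * norm (gradient f z) \<le> 3 * \<tau> * norm (gradient f y)"
proof -
  let ?B = "max (4 * hessian_error y + 24 * M0 * sqrt (2 * gap y / \<mu>)) (\<kappa> * gap y)"
  have *: "\<tau> > 0 \<and> \<tau> \<le> max \<eta> (2 * ?B) \<and> (\<exists>s. z = y + s \<and> trial_accepts f H y \<tau> s)"
    using large_parameter_accepted[OF g] by (intro ms_backtrack_result[OF bt \<eta>]) auto
  then show \<tau>: "\<tau> > 0" by blast
  have "2 * ?B = max (8 * hessian_error y + 48 * M0 * sqrt (2 * gap y / \<mu>)) (2 * gap y * \<kappa>)"
    by (simp add: max_mult_distrib_left mult_ac distrib_left)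
  then show "\<tau> \<le> max \<eta> (max (8 * hessian_error y + 48 * M0 * sqrt (2 * gap y / \<mu>)) (2 * gap y * \<kappa>))"
    using * by metis
  obtain s where z: "z = y + s" and "trial_accepts f H y \<tau> s" using * by blast
  then have acc: "norm (gradient f (y + s) + \<tau> *\<^sub>R s) \<le> \<tau> / 2 * norm s"
    unfolding trial_accepts_def by blast
  show "gap z \<le> (1 - 2 * \<mu> / (3 * \<tau> + 2 * \<mu>))\<^sup>2 * gap y"
    unfolding gap_def z by (rule inexact_prox_step_contraction[OF convex mu_pos \<tau> acc])
  show "(2 * \<mu> + \<tau>) * norm (gradient f z) \<le> 3 * \<tau> * norm (gradient f y)"
    unfolding z by (rule inexact_prox_step_gradient_ratio[OF convex mu_pos \<tau> acc])
qed

text \<open>The factor \<open>1 / 2\<close> is immediate. It is also at most the contraction factor unless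
  \<open>3 B < 2 \<mu>\<close>. In that case \<open>\<tau>\<close> is small compared with \<open>\<mu>\<close>, and the ratio of the gradients, at most
  \<open>3 \<tau> / (2 \<mu> + \<tau>)\<close>, is at most twice the contraction factor for \<open>\<tau>\<close>.\<close>

lemma next_initial_parameter_le:
  assumes \<tau>: "0 < \<tau>" "\<tau> \<le> B" and g: "gradient f y \<noteq> 0"
    and ratio: "(2 * \<mu> + \<tau>) * norm (gradient f z) \<le> 3 * \<tau> * norm (gradient f y)"
  shows "\<tau> / 2 * min 1 (norm (gradient f z) / norm (gradient f y))
    \<le> \<tau> * min (1 / 2) (1 - 2 * \<mu> / (3 * B + 2 * \<mu>))"
proof -
  let ?r = "norm (gradient f z) / norm (gradient f y)" and ?q = "1 - 2 * \<mu> / (3 * B + 2 * \<mu>)"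
  have "min 1 ?r / 2 \<le> ?q"
  proof (cases "2 * \<mu> \<le> 3 * B")
    case True
    then have "1 / 2 \<le> ?q" using mu_pos by (simp add: field_simps)
    moreover have "min 1 ?r / 2 \<le> 1 / 2" by simp
    ultimately show ?thesis by (rule order_trans[rotated])
  next
    case False
    have "?r \<le> 3 * \<tau> / (2 * \<mu> + \<tau>)"
      using ratio g \<tau> mu_pos by (simp add: field_simps)
    also have "\<dots> \<le> 2 * (1 - 2 * \<mu> / (3 * \<tau> + 2 * \<mu>))"
    proof -
      have "3 * \<tau> * (3 * \<tau> + 2 * \<mu>) \<le> 6 * \<tau> * (2 * \<mu> + \<tau>)"
        using False \<tau> mu_pos by (simp add: algebra_simps)
      then have "3 * \<tau> / (2 * \<mu> + \<tau>) \<le> 6 * \<tau> / (3 * \<tau> + 2 * \<mu>)"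
        using \<tau> mu_pos by (simp add: frac_le_eq divide_le_0_iff)
      also have "\<dots> = 2 * (1 - 2 * \<mu> / (3 * \<tau> + 2 * \<mu>))"
        using \<tau> mu_pos by (simp add: field_simps)
      finally show ?thesis .
    qed
    also have "\<dots> \<le> 2 * ?q" using \<tau> mu_pos by (simp add: frac_le)
    finally show ?thesis by (simp add: min_def)
  qed
  then have "min 1 ?r / 2 \<le> min (1 / 2) ?q" by simp
  then have "\<tau> * (min 1 ?r / 2) \<le> \<tau> * min (1 / 2) ?q" using \<tau> by (intro mult_left_mono) auto
  then show ?thesis by simp
qed

text \<open>Induction with the invariant \<open>Inv\<close> on the initial parameter \<open>\<eta> j\<close> and the gap. From the
  maximum of weighted errors only two properties are used: it dominates the current error, and at
  most halves in each iteration.\<close>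

lemma run_bounds:
  assumes run: "regularized_newton_run f H x0 \<eta>0 N x \<eta> \<tau>" and \<eta>0: "\<eta>0 > 0"
    and B1: "\<eta>0 \<le> B" and B2: "8 * \<delta> + 48 * M0 * sqrt (2 * gap x0 / \<mu>) \<le> B"
    and B3: "2 * gap x0 * \<kappa> \<le> B"
    and \<delta>: "\<And>y. hessian_error y \<le> \<delta>"
    and m1: "\<And>k. hessian_error (x k) \<le> m k" and m2: "\<And>k. m k / 2 \<le> m (Suc k)"
    and "k < N"
  shows "\<tau> k \<le> B \<and> \<tau> k \<le> 8 * m k + B * (1 - 2 * \<mu> / (3 * B + 2 * \<mu>)) ^ k
    \<and> gap (x (Suc k)) \<le> (1 - 2 * \<mu> / (3 * \<tau> k + 2 * \<mu>))\<^sup>2 * gap (x k)"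
proof -
  define q where "q = 1 - 2 * \<mu> / (3 * B + 2 * \<mu>)"
  have B: "B > 0" using \<eta>0 B1 by simp
  have q: "0 < q" "q \<le> 1" unfolding q_def using B mu_pos by (simp_all add: field_simps)
  have start: "x 0 = x0" "\<eta> 0 = \<eta>0"
    and g: "\<And>j. j < N \<Longrightarrow> gradient f (x j) \<noteq> 0"
    and bt: "\<And>j. j < N \<Longrightarrow> ms_backtrack f H (x j) (\<eta> j) (x (Suc j)) (\<tau> j)"
    and \<eta>_Suc: "\<And>j. j < N \<Longrightarrow> \<eta> (Suc j) =
          \<tau> j / 2 * min 1 (norm (gradient f (x (Suc j))) / norm (gradient f (x j)))"
    using run[unfolded regularized_newton_run_def] by (blast, blast, blast, blast, blast)
  have m0: "0 \<le> m j" for j using m1[of j] hessian_error_nonneg[of "x j"] by linarith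
  let ?D = "sqrt (2 * gap x0 / \<mu>)"
  have D: "0 \<le> ?D" using gap_nonneg mu_pos by simp
  have \<delta>0: "0 \<le> \<delta>" using \<delta> hessian_error_nonneg order_trans by blast
  define Inv where "Inv j \<longleftrightarrow> 0 < \<eta> j \<and> \<eta> j \<le> B \<and> \<eta> j \<le> 8 * m j + B * q ^ j
      \<and> gap (x j) \<le> (q ^ j)\<^sup>2 * gap x0" for j
  have \<tau>_bounds: "\<tau> j \<le> B \<and> \<tau> j \<le> 8 * m j + B * q ^ j" if "Inv j" "j < N" for j
  proof -
    let ?p = "q ^ j"
    have p: "0 \<le> ?p" "?p \<le> 1" using q by (auto simp: power_le_one)
    have gap: "gap (x j) \<le> ?p\<^sup>2 * gap x0" using that unfolding Inv_def by blast
    have "sqrt (2 * gap (x j) / \<mu>) \<le> sqrt (?p\<^sup>2 * (2 * gap x0 / \<mu>))"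
      using gap mu_pos by (simp add: field_simps)
    also have "\<dots> = ?p * ?D" using p by (simp only: real_sqrt_mult real_sqrt_abs abs_of_nonneg)
    finally have sq: "48 * M0 * sqrt (2 * gap (x j) / \<mu>) \<le> 48 * M0 * (?p * ?D)"
      using M0_nonneg by (intro mult_left_mono) auto
    have MD: "0 \<le> 48 * M0 * ?D" using D M0_nonneg by simp
    have "48 * M0 * ?D * ?p \<le> B * ?p" using B2 \<delta>0 p by (intro mult_right_mono) auto
    moreover have "48 * M0 * ?D * ?p \<le> 48 * M0 * ?D" using mult_left_le[OF p(2) MD] .
    ultimately have 1: "8 * hessian_error (x j) + 48 * M0 * sqrt (2 * gap (x j) / \<mu>) \<le> B"
        "8 * hessian_error (x j) + 48 * M0 * sqrt (2 * gap (x j) / \<mu>) \<le> 8 * m j + B * ?p"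
      using sq B2 \<delta>[of "x j"] m1[of j] by (simp_all add: mult_ac)
    have "2 * gap (x j) * \<kappa> \<le> 2 * (?p\<^sup>2 * gap x0) * \<kappa>"
      using gap kappa_nonneg by (intro mult_right_mono) auto
    also have "\<dots> = (2 * gap x0 * \<kappa>) * ?p\<^sup>2" by simp
    also have "\<dots> \<le> B * ?p\<^sup>2" using B3 by (rule mult_right_mono) simp
    finally have 2: "2 * gap (x j) * \<kappa> \<le> B * ?p\<^sup>2" .
    have "?p\<^sup>2 \<le> ?p" using p by (simp add: power2_eq_square mult_left_le)
    then have "B * ?p\<^sup>2 \<le> B * ?p" "B * ?p \<le> B" using B p by (simp_all add: mult_left_le)
    then have 3: "2 * gap (x j) * \<kappa> \<le> B" "2 * gap (x j) * \<kappa> \<le> 8 * m j + B * ?p"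
      using 2 m0[of j] by linarith+
    show ?thesis
      using iteration_bounds(2)[OF g[OF \<open>j < N\<close>] _ bt[OF \<open>j < N\<close>]] \<open>Inv j\<close> 1 3
      unfolding Inv_def by auto
  qed
  have Inv: "Inv j" if "j < N" for j
    using that
  proof (induction j)
    case 0
    have "B * q ^ 0 = B" by simp
    then show ?case unfolding Inv_def using start \<eta>0 B1 m0[of 0] by simp
  next
    case (Suc j)
    then have I: "Inv j" and j: "j < N" by auto
    let ?t = "\<tau> j"
    note it = iteration_bounds[OF g[OF j] _ bt[OF j]]
    have \<eta>: "0 < \<eta> j" using I unfolding Inv_def by blast
    have t: "0 < ?t" using it(1)[OF \<eta>] .
    have tb: "?t \<le> B" "?t \<le> 8 * m j + B * q ^ j" using \<tau>_bounds[OF I j] by auto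
    have "0 < \<eta> (Suc j)" unfolding \<eta>_Suc[OF j] using t g[OF j] g[OF Suc.prems] by simp
    moreover have up: "\<eta> (Suc j) \<le> ?t * min (1 / 2) q"
      unfolding \<eta>_Suc[OF j] q_def
      by (rule next_initial_parameter_le[OF t tb(1) g[OF j] it(4)[OF \<eta>]])
    moreover have "?t * min (1 / 2) q \<le> ?t * 1" using t q by (intro mult_left_mono) auto
    moreover have "?t * min (1 / 2) q \<le> 8 * m (Suc j) + B * q ^ Suc j"
    proof -
      have "?t * min (1 / 2) q \<le> (8 * m j + B * q ^ j) * min (1 / 2) q"
        using tb(2) q by (intro mult_right_mono) auto
      also have "\<dots> = 8 * (m j * min (1 / 2) q) + B * q ^ j * min (1 / 2) q"
        by (simp add: algebra_simps)
      also have "\<dots> \<le> 8 * (m j * (1 / 2)) + B * q ^ j * q"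
        using m0[of j] q B by (intro add_mono mult_left_mono) auto
      also have "\<dots> \<le> 8 * m (Suc j) + B * q ^ Suc j" using m2[of j] by (simp add: mult_ac)
      finally show ?thesis .
    qed
    moreover have "gap (x (Suc j)) \<le> (q ^ Suc j)\<^sup>2 * gap x0"
    proof -
      have "0 \<le> 1 - 2 * \<mu> / (3 * ?t + 2 * \<mu>)" "1 - 2 * \<mu> / (3 * ?t + 2 * \<mu>) \<le> q"
        using t tb(1) mu_pos unfolding q_def by (simp_all add: frac_le)
      then have "(1 - 2 * \<mu> / (3 * ?t + 2 * \<mu>))\<^sup>2 \<le> q\<^sup>2" by (rule power_mono[rotated])
      then have "(1 - 2 * \<mu> / (3 * ?t + 2 * \<mu>))\<^sup>2 * gap (x j) \<le> q\<^sup>2 * ((q ^ j)\<^sup>2 * gap x0)"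
        using I gap_nonneg unfolding Inv_def by (intro mult_mono) auto
      then show ?thesis using it(3)[OF \<eta>] by (simp add: power_mult_distrib mult_ac)
    qed
    ultimately show ?case unfolding Inv_def using tb(1) by auto
  qed
  have "0 < \<eta> k" using Inv[OF \<open>k < N\<close>] unfolding Inv_def by blast
  then show ?thesis
    using \<tau>_bounds[OF Inv] iteration_bounds(3)[OF g _ bt] \<open>k < N\<close> unfolding q_def by blast
qed

end

section \<open>Radius and threshold\<close>

text \<open>The extended real arithmetic is confined to this lemma. A finite radius \<open>r\<close> gives
  \<open>\<kappa> = 1 / r\<^sup>2\<close>. Then \<open>\<kappa> d\<^sup>2 \<le> 2\<close> means \<open>d \<le> \<surd>2 r\<close>, which is below \<open>2 r \<le> \<rho>\<close>, and
  \<open>M1 r\<^sup>2 \<le> 1 / 36\<close> doubles to \<open>1 / 18\<close>.\<close>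

lemma step_radius_curvature:
  fixes f :: "real^'n \<Rightarrow> real"
  assumes smooth: "hessian_smooth \<rho> M0 M1 f" and M1: "0 \<le> M1"
  obtains \<kappa> where "0 \<le> \<kappa>" and "steps_controlled \<kappa> M0 M1 f"
    and "\<And>\<Delta>. real_of_ereal (ereal (2 * \<Delta>) / (step_radius \<rho> M1)\<^sup>2) = 2 * \<Delta> * \<kappa>"
proof (cases "step_radius \<rho> M1 = \<infinity>")
  case True
  then have "\<rho> / 2 = \<infinity>" "1 / (6 * ereal (sqrt M1)) = \<infinity>"
    unfolding step_radius_def by (auto simp: min_def split: if_splits)
  have "M1 = 0"
    using \<open>1 / (6 * ereal (sqrt M1)) = \<infinity>\<close> M1 by (cases "M1 = 0") (auto simp: one_ereal_def)
  moreover have "global_hessian_smooth M0 M1 f"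
    using smooth \<open>\<rho> / 2 = \<infinity>\<close> unfolding hessian_smooth_def by auto
  ultimately have "steps_controlled 0 M0 M1 f"
    unfolding steps_controlled_def global_hessian_smooth_def by simp
  then show ?thesis using True by (intro that[of 0]) auto
next
  case False
  have "0 < \<rho> / 2"
    using smooth unfolding hessian_smooth_def by auto
  moreover have "0 < 1 / (6 * ereal (sqrt M1))"
    using M1 by (cases "M1 = 0") (auto simp: one_ereal_def)
  ultimately have "0 < step_radius \<rho> M1" unfolding step_radius_def by simp
  then obtain r where r: "step_radius \<rho> M1 = ereal r" "0 < r"
    using False by (cases "step_radius \<rho> M1") auto
  then have le: "ereal r \<le> \<rho> / 2" "ereal r \<le> 1 / (6 * ereal (sqrt M1))"
    unfolding step_radius_def by (metis min.cobounded1 min.cobounded2)+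
  have M1r: "M1 * r\<^sup>2 \<le> 1 / 36"
  proof (cases "M1 = 0")
    case False
    then have "r * sqrt M1 \<le> 1 / 6"
      using le(2) M1 by (simp add: one_ereal_def field_simps)
    then have "(r * sqrt M1)\<^sup>2 \<le> (1 / 6)\<^sup>2" using r M1 by (intro power_mono) auto
    then show ?thesis using M1 by (simp add: power_mult_distrib power2_eq_square mult_ac)
  qed simp
  have "steps_controlled (1 / r\<^sup>2) M0 M1 f"
    unfolding steps_controlled_def
  proof (intro allI impI conjI)
    fix a b :: "real^'n"
    assume "1 / r\<^sup>2 * (norm (b - a))\<^sup>2 \<le> 2"
    then have n: "(norm (b - a))\<^sup>2 \<le> 2 * r\<^sup>2" using r by (simp add: field_simps)
    then have "M1 * (norm (b - a))\<^sup>2 \<le> M1 * (2 * r\<^sup>2)" using M1 by (rule mult_left_mono)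
    then show "M1 * (norm (b - a))\<^sup>2 \<le> 1 / 18" using M1r by simp
    note n
    also have "2 * r\<^sup>2 \<le> (2 * r)\<^sup>2" by (simp add: power_mult_distrib)
    finally have "(norm (b - a))\<^sup>2 \<le> (2 * r)\<^sup>2" .
    then have "norm (b - a) \<le> 2 * r" by (rule power2_le_imp_le) (use r in simp)
    moreover have "2 * r \<le> s" if "\<rho> = ereal s" for s using le(1) that by simp
    ultimately show "op_norm (hessian f b - hessian f a)
        \<le> (M0 + M1 * norm (gradient f a)) * norm (b - a)"
      using smooth unfolding hessian_smooth_def global_hessian_smooth_def local_hessian_smooth_def
      by (metis order_trans)
  qed
  then show ?thesis using r by (intro that[of "1 / r\<^sup>2"]) (auto simp: power2_eq_square)
qed

theorem theorem3p3:
  fixes f :: "real^'n \<Rightarrow> real" and H :: "real^'n \<Rightarrow> real^'n^'n"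
    and xstar x0 :: "real^'n" and \<mu> \<delta> M0 M1 \<eta>0 \<tau>bar :: real and \<rho> :: ereal
    and x :: "nat \<Rightarrow> real^'n" and \<eta> \<tau> \<delta>s :: "nat \<Rightarrow> real" and N k :: nat
  assumes "\<mu> > 0"
    and "strongly_convex \<mu> f"
    and "twice_continuously_differentiable f"
    and "\<And>y. f xstar \<le> f y"
    and "\<And>y. transpose (H y) = H y"
    and "\<And>y. op_norm (H y - hessian f y) \<le> \<delta>"
    and "M0 \<ge> 0" and "M1 \<ge> 0"
    and "hessian_smooth \<rho> M0 M1 f"
    and "\<eta>0 > 0"
    and "\<tau>bar = tau_bar \<eta>0 \<delta> \<mu> M0 M1 \<rho> (f x0 - f xstar)"
    and "regularized_newton_run f H x0 \<eta>0 N x \<eta> \<tau>"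
    and "\<And>j. \<delta>s j = op_norm (H (x j) - hessian f (x j))"
    and "k < N"
  shows "\<tau> k \<le> \<tau>bar
    \<and> \<tau> k \<le> 8 * (MAX j\<in>{0..k}. 2 powi (int j - int k) * \<delta>s j)
             + \<tau>bar * (1 - 2 * \<mu> / (3 * \<tau>bar + 2 * \<mu>)) ^ k
    \<and> f (x (Suc k)) - f xstar
        \<le> (1 - 2 * \<mu> / (3 * \<tau> k + 2 * \<mu>))\<^sup>2 * (f (x k) - f xstar)"
proof -
  obtain \<kappa> where \<kappa>: "0 \<le> \<kappa>" "steps_controlled \<kappa> M0 M1 f"
    and third: "\<And>\<Delta>. real_of_ereal (ereal (2 * \<Delta>) / (step_radius \<rho> M1)\<^sup>2) = 2 * \<Delta> * \<kappa>"
    using step_radius_curvature[OF assms(9,8)] by blast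
  interpret regularized_newton f H xstar \<mu> M0 M1 \<kappa>
    using assms \<kappa> unfolding twice_continuously_differentiable_def by unfold_locales auto
  define m where "m k = (MAX j\<in>{0..k}. 2 powi (int j - int k) * \<delta>s j)" for k
  have \<delta>s: "\<delta>s j = hessian_error (x j)" for j
    using assms(13) by (simp add: hessian_error_def)
  have m_ge: "2 powi (int j - int k) * \<delta>s j \<le> m k" if "j \<le> k" for j k
    unfolding m_def using that by (intro Max_ge) auto
  have m1: "hessian_error (x k) \<le> m k" for k
    using m_ge[of k k] by (simp add: \<delta>s)
  have m2: "m k / 2 \<le> m (Suc k)" for k
  proof -
    have "m k \<in> (\<lambda>j. 2 powi (int j - int k) * \<delta>s j) ` {0..k}"
      unfolding m_def by (rule Max_in) auto
    then obtain j where j: "j \<le> k" "m k = 2 powi (int j - int k) * \<delta>s j" by auto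
    have "(2::real) powi (int j - int (Suc k)) = 2 powi (int j - int k) / 2"
      using power_int_diff[of "2::real" "int j - int k" 1] by (simp add: algebra_simps)
    then have "m k / 2 = 2 powi (int j - int (Suc k)) * \<delta>s j" using j by simp
    also have "\<dots> \<le> m (Suc k)" using m_ge[of j "Suc k"] j by simp
    finally show ?thesis .
  qed
  have B: "\<tau>bar = Max {\<eta>0, 8 * \<delta> + 48 * M0 * sqrt (2 * gap x0 / \<mu>), 2 * gap x0 * \<kappa>}"
    unfolding assms(11) tau_bar_def third gap_def ..
  have "\<tau> k \<le> \<tau>bar \<and> \<tau> k \<le> 8 * m k + \<tau>bar * (1 - 2 * \<mu> / (3 * \<tau>bar + 2 * \<mu>)) ^ k
    \<and> gap (x (Suc k)) \<le> (1 - 2 * \<mu> / (3 * \<tau> k + 2 * \<mu>))\<^sup>2 * gap (x k)"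
  proof (rule run_bounds[where m = m, OF assms(12,10) _ _ _ _ m1 m2 assms(14)])
    show "\<eta>0 \<le> \<tau>bar" "8 * \<delta> + 48 * M0 * sqrt (2 * gap x0 / \<mu>) \<le> \<tau>bar" "2 * gap x0 * \<kappa> \<le> \<tau>bar"
      unfolding B by simp_all
    show "hessian_error y \<le> \<delta>" for y
      using assms(6) by (simp add: hessian_error_def)
  qed
  then show ?thesis unfolding m_def gap_def .
qed

end
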